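(* Let $G$ be a digraph and let $f: V(G)\to[0,+\infty)$ be a discrete Morse function on $G$. Then $f$ is a discrete flat Witten-Morse function on $G$.
   Context: A digraph $G$ consists of a finite vertex set $V=V(G)$ and a non-empty edge set $E\subseteq V\times V\setminus\mathrm{diag}$; $(u,v)\in E$ is written $u\to v$. An allowed elementary $n$-path on $G$ ($n\ge 0$) is a sequence $v_0v_1\cdots v_n$ of vertices with $v_{i-1}\to v_i$ an edge of $G$ for each $1\le i\le n$. For allowed elementary paths $\alpha,\beta$, write $\alpha>\beta$ (or $\beta<\alpha$) if $\beta$ is obtained from $\alpha$ by removing some vertices. A superscript, as in $\alpha^{(n)}$, indicates that $\alpha$ is an allowed elementary $n$-path. For $f:V(G)\to[0,+\infty)$ and $\alpha=v_0\cdots v_n$ put $f(\alpha)=\sum_{i=0}^n f(v_i)$. Discrete Morse function: $f: V(G)\to[0,+\infty)$ such that for every allowed elementary path $\alpha^{(n)}$ on $G$, $\#\{\gamma^{(n+1)}>\alpha^{(n)} \mid f(\gamma)=f(\alpha)\}\le 1$ and $\#\{\beta^{(n-1)}<\alpha^{(n)} \mid f(\beta)=f(\alpha)\}\le 1$, where $\gamma,\beta$ range over allowed elementary paths on $G$. Discrete Witten-Morse function: $f: V(G)\to[0,+\infty)$ such that for every allowed elementary path $\alpha$: (i) $f(\alpha)<\frac12\big(f(\gamma_1)+f(\gamma_2)\big)$ whenever $\gamma_1>\alpha$, $\gamma_2>\alpha$, $\gamma_1\ne\gamma_2$; (ii) $f(\alpha)>\frac12\big(f(\beta_1)+f(\beta_2)\big)$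 whenever $\beta_1<\alpha$, $\beta_2<\alpha$, $\beta_1\neq\beta_2$. A discrete Witten-Morse function is flat if for every allowed elementary path $\alpha$: (i) $f(\alpha)\le\min\{f(\gamma_1),f(\gamma_2)\}$ whenever $\gamma_1>\alpha$, $\gamma_2>\alpha$, $\gamma_1\ne\gamma_2$; (ii) $f(\alpha)\ge\max\{f(\beta_1),f(\beta_2)\}$ whenever $\beta_1<\alpha$, $\beta_2<\alpha$, $\beta_1\ne\beta_2$. All $\gamma_i,\beta_i$ are allowed elementary paths on $G$. *)

theory Defs
  imports
    Complex_Main
    "HOL-Library.Sublist"
    "Graph_Theory.Pair_Digraph"
    "Graph_Theory.Vertex_Walk"
begin

text \<open>
  Digraphs are the locale \<open>pair_digraph\<close> (finite vertex set, arcs a set of pairs of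
  distinct vertices) together with a non-empty arc set.  An allowed elementary
  \<open>n\<close>-path \<open>v\<^sub>0 \<dots> v\<^sub>n\<close> is a \<open>vwalk\<close> with \<open>vwalk_length\<close> equal to \<open>n\<close>;
  vertices may repeat and the empty list is excluded.
\<close>

definition is_digraph :: "'a pair_pre_digraph \<Rightarrow> bool" where
  "is_digraph G \<longleftrightarrow> pair_digraph G \<and> parcs G \<noteq> {}"

definition allowed_path :: "'a pair_pre_digraph \<Rightarrow> 'a list \<Rightarrow> bool" where
  "allowed_path G \<alpha> \<longleftrightarrow> vwalk \<alpha> (with_proj G)"

text \<open>
  At least one vertex is removed, possibly several and possibly end points.
  Paths are compared as vertex sequences, so different ways of
  removing vertices that leave the same sequence give the same path.
\<close>

definition path_less :: "'a list \<Rightarrow> 'a list \<Rightarrow> bool" where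
  "path_less \<beta> \<alpha> \<longleftrightarrow> strict_subseq \<beta> \<alpha>"

definition path_value :: "('a \<Rightarrow> real) \<Rightarrow> 'a list \<Rightarrow> real" where
  "path_value f \<alpha> = (\<Sum>v\<leftarrow>\<alpha>. f v)"

text \<open>
  A function \<open>V(G) \<rightarrow> [0, \<infinity>)\<close> is a total function that is nonnegative on the vertices;
  its values elsewhere are never used.
\<close>

definition nonneg_on_verts :: "'a pair_pre_digraph \<Rightarrow> ('a \<Rightarrow> real) \<Rightarrow> bool" where
  "nonneg_on_verts G f \<longleftrightarrow> (\<forall>v \<in> pverts G. 0 \<le> f v)"

text \<open>
  The two sets below are finite because \<open>G\<close> has finitely many vertices and the
  length of the paths is fixed, so \<open>card\<close> counts their elements.
\<close>

definition discrete_Morse :: "'a pair_pre_digraph \<Rightarrow> ('a \<Rightarrow> real) \<Rightarrow> bool" where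
  "discrete_Morse G f \<longleftrightarrow> nonneg_on_verts G f \<and>
    (\<forall>\<alpha>. allowed_path G \<alpha> \<longrightarrow>
      card {\<gamma>. allowed_path G \<gamma> \<and> vwalk_length \<gamma> = vwalk_length \<alpha> + 1 \<and>
               path_less \<alpha> \<gamma> \<and> path_value f \<gamma> = path_value f \<alpha>} \<le> 1 \<and>
      card {\<beta>. allowed_path G \<beta> \<and> vwalk_length \<beta> + 1 = vwalk_length \<alpha> \<and>
               path_less \<beta> \<alpha> \<and> path_value f \<beta> = path_value f \<alpha>} \<le> 1)"

definition discrete_Witten_Morse :: "'a pair_pre_digraph \<Rightarrow> ('a \<Rightarrow> real) \<Rightarrow> bool" where
  "discrete_Witten_Morse G f \<longleftrightarrow> nonneg_on_verts G f \<and>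
    (\<forall>\<alpha>. allowed_path G \<alpha> \<longrightarrow>
      (\<forall>\<gamma>\<^sub>1 \<gamma>\<^sub>2. allowed_path G \<gamma>\<^sub>1 \<and> allowed_path G \<gamma>\<^sub>2 \<and>
          path_less \<alpha> \<gamma>\<^sub>1 \<and> path_less \<alpha> \<gamma>\<^sub>2 \<and> \<gamma>\<^sub>1 \<noteq> \<gamma>\<^sub>2 \<longrightarrow>
        path_value f \<alpha> < 1/2 * (path_value f \<gamma>\<^sub>1 + path_value f \<gamma>\<^sub>2)) \<and>
      (\<forall>\<beta>\<^sub>1 \<beta>\<^sub>2. allowed_path G \<beta>\<^sub>1 \<and> allowed_path G \<beta>\<^sub>2 \<and>
          path_less \<beta>\<^sub>1 \<alpha> \<and> path_less \<beta>\<^sub>2 \<alpha> \<and> \<beta>\<^sub>1 \<noteq> \<beta>\<^sub>2 \<longrightarrow>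
        path_value f \<alpha> > 1/2 * (path_value f \<beta>\<^sub>1 + path_value f \<beta>\<^sub>2)))"

definition discrete_flat_Witten_Morse :: "'a pair_pre_digraph \<Rightarrow> ('a \<Rightarrow> real) \<Rightarrow> bool" where
  "discrete_flat_Witten_Morse G f \<longleftrightarrow> discrete_Witten_Morse G f \<and>
    (\<forall>\<alpha>. allowed_path G \<alpha> \<longrightarrow>
      (\<forall>\<gamma>\<^sub>1 \<gamma>\<^sub>2. allowed_path G \<gamma>\<^sub>1 \<and> allowed_path G \<gamma>\<^sub>2 \<and>
          path_less \<alpha> \<gamma>\<^sub>1 \<and> path_less \<alpha> \<gamma>\<^sub>2 \<and> \<gamma>\<^sub>1 \<noteq> \<gamma>\<^sub>2 \<longrightarrow>
        path_value f \<alpha> \<le> min (path_value f \<gamma>\<^sub>1) (path_value f \<gamma>\<^sub>2)) \<and>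
      (\<forall>\<beta>\<^sub>1 \<beta>\<^sub>2. allowed_path G \<beta>\<^sub>1 \<and> allowed_path G \<beta>\<^sub>2 \<and>
          path_less \<beta>\<^sub>1 \<alpha> \<and> path_less \<beta>\<^sub>2 \<alpha> \<and> \<beta>\<^sub>1 \<noteq> \<beta>\<^sub>2 \<longrightarrow>
        path_value f \<alpha> \<ge> max (path_value f \<beta>\<^sub>1) (path_value f \<beta>\<^sub>2)))"

end

theory Submission
  imports Defs
begin

text \<open>
  Let \<open>\<beta> < \<gamma>\<close> be allowed paths with \<open>f(\<beta>) = f(\<gamma>)\<close>.  All removed vertices are zeros of \<open>f\<close>.
  The endpoints of an edge are not both zeros, since the edge would then have two faces of the
  same value as itself.  Hence the vertices of \<open>\<gamma>\<close> next to a removed one are kept.  If at least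
  two vertices are removed, then the first or the second of them can be removed alone: each gives
  an allowed face of \<open>\<gamma>\<close> of value \<open>f(\<gamma>)\<close>, and the two faces differ because \<open>G\<close> has no loops.
  This contradicts the Morse condition, so exactly one vertex is removed.  The Morse condition
  thus bounds all subpaths and superpaths of equal value, and all other values move strictly in
  the right direction because \<open>f \<ge> 0\<close>.
\<close>

section \<open>Values of lists under removal of entries\<close>

lemma path_value_simps [simp]:
  "path_value f [] = 0"
  "path_value f (v # \<alpha>) = f v + path_value f \<alpha>"
  "path_value f (\<alpha> @ \<beta>) = path_value f \<alpha> + path_value f \<beta>"
  by (simp_all add: path_value_def)

lemma path_value_subseq_mono:
  assumes "subseq \<beta> \<alpha>" and "\<forall>v\<in>set \<alpha>. 0 \<le> f v"
  shows "path_value f \<beta> \<le> path_value f \<alpha>"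
  using assms
proof (induction rule: list_emb.induct)
  case (list_emb_Nil \<alpha>)
  then have "0 \<le> path_value f \<alpha>" unfolding path_value_def by (intro sum_list_nonneg) auto
  then show ?case by simp
qed (simp_all add: add_increasing)

text \<open>Removing \<open>v\<close> would leave a subsequence of \<open>\<alpha>\<close>, which
  loses at least \<open>f v > 0\<close>.\<close>

lemma hd_eq_of_path_value_eq:
  assumes "subseq \<beta> (v # \<alpha>)" and "\<forall>u\<in>set (v # \<alpha>). 0 \<le> f u"
    and "path_value f \<beta> = path_value f (v # \<alpha>)" and "f v \<noteq> 0"
  shows "\<beta> \<noteq> [] \<and> hd \<beta> = v"
proof (rule ccontr)
  assume "\<not> (\<beta> \<noteq> [] \<and> hd \<beta> = v)"
  then have "subseq \<beta> \<alpha>" using assms(1) by (cases \<beta>) (auto split: if_splits)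
  then have "path_value f \<beta> \<le> path_value f \<alpha>"
    using assms(2) by (intro path_value_subseq_mono) auto
  moreover have "0 < f v" using assms(2,4) by force
  ultimately show False using assms(3) by simp
qed

text \<open>Here \<open>v\<close> is the first entry removed by a suitable embedding. Embeddings
  need not be unique; the induction drops the head as soon as the tail still contains
  \<open>\<beta>\<close>.\<close>

lemma strict_subseq_first_difference:
  assumes "strict_subseq \<beta> \<alpha>"
  obtains ps v cs qs where "\<beta> = ps @ cs" "\<alpha> = ps @ v # qs" "subseq cs qs"
proof -
  have "\<exists>ps v cs qs. \<beta> = ps @ cs \<and> \<alpha> = ps @ v # qs \<and> subseq cs qs"
    using assms
  proof (induction \<alpha> arbitrary: \<beta>)
    case Nil
    then show ?case by (auto simp: strict_subseq_def dest: list_emb_Nil2)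
  next
    case (Cons v \<alpha>)
    show ?case
    proof (cases "subseq \<beta> \<alpha>")
      case True
      then show ?thesis by (metis append_Nil)
    next
      case False
      then obtain \<beta>' where \<beta>: "\<beta> = v # \<beta>'" "subseq \<beta>' \<alpha>"
        using Cons.prems by (cases \<beta>) (auto simp: strict_subseq_def split: if_splits)
      then have "strict_subseq \<beta>' \<alpha>"
        using Cons.prems by (auto simp: strict_subseq_def)
      from Cons.IH[OF this] show ?thesis
        unfolding \<beta>(1) by (metis append_Cons)
    qed
  qed
  then show thesis using that by blast
qed

text \<open>By nonnegativity neither the loss at \<open>v\<close> nor the loss from
  \<open>qs\<close> to \<open>cs\<close> is negative; their sum is zero, so both vanish. The
  successor of \<open>v\<close> is then not a zero and cannot be removed.\<close>

lemma strict_subseq_same_value_first_difference: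
  assumes "strict_subseq \<beta> \<alpha>" and "\<forall>v\<in>set \<alpha>. 0 \<le> f v"
    and "path_value f \<beta> = path_value f \<alpha>"
    and "successively R \<alpha>" and "\<And>u v. R u v \<Longrightarrow> \<not> (f u = 0 \<and> f v = 0)"
  obtains ps v cs qs where "\<beta> = ps @ cs" "\<alpha> = ps @ v # qs" "subseq cs qs"
    "path_value f cs = path_value f qs" "f v = 0"
    "qs \<noteq> [] \<longrightarrow> f (hd qs) \<noteq> 0 \<and> cs \<noteq> [] \<and> hd cs = hd qs"
proof -
  obtain ps v cs qs where eq: "\<beta> = ps @ cs" "\<alpha> = ps @ v # qs" "subseq cs qs"
    using strict_subseq_first_difference[OF assms(1)] .
  have "path_value f cs \<le> path_value f qs"
    using eq assms(2) by (intro path_value_subseq_mono) auto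
  moreover have "0 \<le> f v" using eq assms(2) by simp
  ultimately have *: "f v = 0" "path_value f cs = path_value f qs"
    using assms(3) eq by auto
  have hd: "f (hd qs) \<noteq> 0 \<and> cs \<noteq> [] \<and> hd cs = hd qs" if nonempty: "qs \<noteq> []"
  proof -
    obtain w qs' where qs: "qs = w # qs'" using nonempty by (cases qs) auto
    have "R v w" using assms(4) eq qs by (simp add: successively_append_iff)
    then have "f w \<noteq> 0" using assms(5) * by blast
    with hd_eq_of_path_value_eq[of cs w qs' f] show ?thesis
      using eq(2,3) qs *(2) assms(2) by auto
  qed
  show thesis by (rule that[OF eq *(2,1)]) (use hd in blast)
qed

lemma two_faces_same_value:
  assumes "strict_subseq \<beta> \<alpha>" and "length \<beta> + 2 \<le> length \<alpha>" and "\<forall>v\<in>set \<alpha>. 0 \<le> f v"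
    and "path_value f \<beta> = path_value f \<alpha>"
    and "successively R \<beta>" and "successively R \<alpha>"
    and edge: "\<And>u v. R u v \<Longrightarrow> u \<noteq> v \<and> \<not> (f u = 0 \<and> f v = 0)"
  obtains \<delta>\<^sub>1 \<delta>\<^sub>2 where "\<delta>\<^sub>1 \<noteq> \<delta>\<^sub>2"
    "\<And>\<delta>. \<delta> \<in> {\<delta>\<^sub>1, \<delta>\<^sub>2} \<Longrightarrow> strict_subseq \<delta> \<alpha> \<and> length \<delta> + 1 = length \<alpha>
      \<and> path_value f \<delta> = path_value f \<alpha> \<and> successively R \<delta>"
proof -
  have zeros: "\<not> (f u = 0 \<and> f v = 0)" if "R u v" for u v
    using edge[OF that] by blast
  obtain ps v cs qs where 1: "\<beta> = ps @ cs" "\<alpha> = ps @ v # qs" "subseq cs qs"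
    "path_value f cs = path_value f qs" "f v = 0"
    "qs \<noteq> [] \<longrightarrow> f (hd qs) \<noteq> 0 \<and> cs \<noteq> [] \<and> hd cs = hd qs"
    by (rule strict_subseq_same_value_first_difference[OF assms(1,3,4,6) zeros])
  \<comment> \<open>\<open>v\<close> accounts for only one of the at least two missing entries, so
    the decomposition can be repeated for \<open>cs\<close> and \<open>qs\<close>.\<close>
  have strict: "strict_subseq cs qs"
    using 1(1-3) assms(2) by (auto simp: strict_subseq_def)
  have qs: "\<forall>v\<in>set qs. 0 \<le> f v" "successively R qs"
    using 1(2) assms(3,6) by (auto simp: successively_append_iff successively_Cons)
  obtain rs w ds ss where 2: "cs = rs @ ds" "qs = rs @ w # ss" "subseq ds ss"
    "path_value f ds = path_value f ss" "f w = 0"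
    "ss \<noteq> [] \<longrightarrow> f (hd ss) \<noteq> 0 \<and> ds \<noteq> [] \<and> hd ds = hd ss"
    by (rule strict_subseq_same_value_first_difference[OF strict qs(1) 1(4) qs(2) zeros])
  \<comment> \<open>Otherwise \<open>w\<close> would be the head of \<open>qs\<close>, which is not
    a zero of \<open>f\<close>.\<close>
  have "rs \<noteq> []" using 1(6) 2(2,5) by auto
  let ?\<delta>\<^sub>1 = "ps @ qs" and ?\<delta>\<^sub>2 = "ps @ v # rs @ ss"
  \<comment> \<open>After \<open>ps\<close>, the first face continues with \<open>hd rs\<close> and
    the second with \<open>v\<close>; these are joined by an edge, hence distinct.\<close>
  have "v \<noteq> hd rs"
    using edge[of v "hd rs"] assms(6) 1(2) 2(2) \<open>rs \<noteq> []\<close>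
    by (auto simp: successively_append_iff successively_Cons)
  then have "?\<delta>\<^sub>1 \<noteq> ?\<delta>\<^sub>2" using 2(2) \<open>rs \<noteq> []\<close> by (cases rs) auto
  \<comment> \<open>The only new adjacency is from the end of \<open>ps\<close> to
    \<open>hd qs = hd cs\<close>, which already occurs in \<open>\<beta>\<close>.\<close>
  have "successively R ?\<delta>\<^sub>1"
    using assms(5,6) 1(1,2,6) 2(2) by (auto simp: successively_append_iff successively_Cons)
  \<comment> \<open>The only new adjacency, present if \<open>ss\<close> is nonempty, is from
    \<open>last rs\<close> to \<open>hd ss = hd ds\<close>; it occurs in
    \<open>\<beta> = ps @ rs @ ds\<close>.\<close>
  moreover have "successively R ?\<delta>\<^sub>2"
    using assms(5,6) 1(1,2) 2(1,2,6) \<open>rs \<noteq> []\<close>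
    by (auto simp: successively_append_iff successively_Cons)
  moreover have "subseq ?\<delta>\<^sub>1 \<alpha>" "subseq ?\<delta>\<^sub>2 \<alpha>"
    using 1(2) 2(2) by (auto simp: subseq_append')
  ultimately have "\<forall>\<delta>\<in>{?\<delta>\<^sub>1, ?\<delta>\<^sub>2}. strict_subseq \<delta> \<alpha> \<and> length \<delta> + 1 = length \<alpha>
      \<and> path_value f \<delta> = path_value f \<alpha> \<and> successively R \<delta>"
    using 1(2,5) 2(2,5) by (auto simp: strict_subseq_def)
  with \<open>?\<delta>\<^sub>1 \<noteq> ?\<delta>\<^sub>2\<close> show thesis by (intro that[of ?\<delta>\<^sub>1 ?\<delta>\<^sub>2]) blast+
qed

section \<open>Allowed paths as lists\<close>

lemma set_vwalk_arcs_subset_iff: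
  "set (vwalk_arcs \<alpha>) \<subseteq> A \<longleftrightarrow> successively (\<lambda>u v. (u, v) \<in> A) \<alpha>"
  by (induction \<alpha> rule: vwalk_arcs.induct) auto

lemma allowed_path_iff:
  "allowed_path G \<alpha> \<longleftrightarrow>
    \<alpha> \<noteq> [] \<and> set \<alpha> \<subseteq> pverts G \<and> successively (\<lambda>u v. (u, v) \<in> parcs G) \<alpha>"
  by (auto simp: allowed_path_def vwalk_def set_vwalk_arcs_subset_iff)

text \<open>Since \<open>card\<close> is 0 on infinite sets, the Morse bounds yield uniqueness only
  for sets known to be finite.\<close>

lemma finite_allowed_paths:
  assumes "finite (pverts G)"
  shows "finite {\<alpha>. allowed_path G \<alpha> \<and> length \<alpha> \<le> n}"
  by (rule finite_subset[OF _ finite_lists_length_le[OF assms, of n]])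
    (auto simp: allowed_path_iff)

section \<open>Consequences of the Morse condition\<close>

locale Morse_function =
  fixes G :: "'a pair_pre_digraph" and f :: "'a \<Rightarrow> real"
  assumes digraph: "is_digraph G" and Morse: "discrete_Morse G f"
begin

sublocale pair_digraph G
  using digraph by (simp add: is_digraph_def)

lemma nonneg_on_path: "allowed_path G \<alpha> \<Longrightarrow> \<forall>v\<in>set \<alpha>. 0 \<le> f v"
  using Morse by (auto simp: discrete_Morse_def nonneg_on_verts_def allowed_path_iff)

lemma face_unique:
  assumes "allowed_path G \<alpha>"
    and "allowed_path G \<beta>\<^sub>1" "length \<beta>\<^sub>1 + 1 = length \<alpha>" "path_less \<beta>\<^sub>1 \<alpha>"
      "path_value f \<beta>\<^sub>1 = path_value f \<alpha>"
    and "allowed_path G \<beta>\<^sub>2" "length \<beta>\<^sub>2 + 1 = length \<alpha>" "path_less \<beta>\<^sub>2 \<alpha>"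
      "path_value f \<beta>\<^sub>2 = path_value f \<alpha>"
  shows "\<beta>\<^sub>1 = \<beta>\<^sub>2"
proof -
  let ?S = "{\<beta>. allowed_path G \<beta> \<and> vwalk_length \<beta> + 1 = vwalk_length \<alpha> \<and>
    path_less \<beta> \<alpha> \<and> path_value f \<beta> = path_value f \<alpha>}"
  have "finite ?S"
    by (rule finite_subset[OF _ finite_allowed_paths[OF pair_finite_verts, of "length \<alpha>"]]) auto
  moreover have "card ?S \<le> Suc 0"
    using Morse assms(1) unfolding discrete_Morse_def by simp
  \<comment> \<open>\<open>vwalk_length\<close> is \<open>length - 1\<close> with truncated
    subtraction, so passing from one to the other needs nonempty lists.\<close>
  moreover have "\<beta>\<^sub>1 \<noteq> []" "\<beta>\<^sub>2 \<noteq> []"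
    using assms(2,6) by (auto simp: allowed_path_iff)
  then have "length \<beta>\<^sub>1 - 1 + 1 = length \<alpha> - 1" "length \<beta>\<^sub>2 - 1 + 1 = length \<alpha> - 1"
    using assms(3,7) by (cases \<beta>\<^sub>1; cases \<beta>\<^sub>2; simp)+
  then have "\<beta>\<^sub>1 \<in> ?S" "\<beta>\<^sub>2 \<in> ?S"
    using assms by auto
  ultimately show ?thesis by (simp only: card_le_Suc0_iff_eq)
qed

lemma coface_unique:
  assumes "allowed_path G \<alpha>"
    and "allowed_path G \<gamma>\<^sub>1" "length \<gamma>\<^sub>1 = length \<alpha> + 1" "path_less \<alpha> \<gamma>\<^sub>1"
      "path_value f \<gamma>\<^sub>1 = path_value f \<alpha>"
    and "allowed_path G \<gamma>\<^sub>2" "length \<gamma>\<^sub>2 = length \<alpha> + 1" "path_less \<alpha> \<gamma>\<^sub>2"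
      "path_value f \<gamma>\<^sub>2 = path_value f \<alpha>"
  shows "\<gamma>\<^sub>1 = \<gamma>\<^sub>2"
proof -
  let ?S = "{\<gamma>. allowed_path G \<gamma> \<and> vwalk_length \<gamma> = vwalk_length \<alpha> + 1 \<and>
    path_less \<alpha> \<gamma> \<and> path_value f \<gamma> = path_value f \<alpha>}"
  \<comment> \<open>The bound exceeds \<open>length \<alpha>\<close> by 2, not 1, because truncation
    lets an empty \<open>\<alpha>\<close> be followed by a list of length 2.\<close>
  have "finite ?S"
    by (rule finite_subset[OF _ finite_allowed_paths[OF pair_finite_verts, of "length \<alpha> + 2"]])
      auto
  moreover have "card ?S \<le> Suc 0"
    using Morse assms(1) unfolding discrete_Morse_def by simp
  moreover have "\<alpha> \<noteq> []"
    using assms(1) by (auto simp: allowed_path_iff)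
  then have "\<gamma>\<^sub>1 \<in> ?S" "\<gamma>\<^sub>2 \<in> ?S"
    using assms by auto
  ultimately show ?thesis by (simp only: card_le_Suc0_iff_eq)
qed

lemma edge_distinct_not_both_zero:
  assumes "(u, v) \<in> parcs G"
  shows "u \<noteq> v \<and> \<not> (f u = 0 \<and> f v = 0)"
proof -
  have "u \<noteq> v" using pair_no_loops[OF assms] by simp
  moreover have "u \<in> pverts G" "v \<in> pverts G"
    using assms wellformed' by blast+
  ultimately show ?thesis
    using face_unique[of "[u, v]" "[u]" "[v]"] assms
    by (auto simp: allowed_path_iff path_less_def strict_subseq_def)
qed

lemma path_value_mono:
  assumes "allowed_path G \<alpha>" and "path_less \<beta> \<alpha>"
  shows "path_value f \<beta> \<le> path_value f \<alpha>"
  using assms path_value_subseq_mono[OF _ nonneg_on_path]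
  by (auto simp: path_less_def strict_subseq_def)

text \<open>The Morse condition compares only paths whose lengths differ by one; this lemma carries
  it over to all pairs \<open>\<beta> < \<alpha>\<close>.\<close>

lemma length_of_same_value:
  assumes \<alpha>: "allowed_path G \<alpha>" and \<beta>: "allowed_path G \<beta>" and less: "path_less \<beta> \<alpha>"
    and val: "path_value f \<beta> = path_value f \<alpha>"
  shows "length \<alpha> = length \<beta> + 1"
proof (rule ccontr)
  assume neq: "length \<alpha> \<noteq> length \<beta> + 1"
  have strict: "strict_subseq \<beta> \<alpha>" using less by (simp add: path_less_def)
  then have "length \<beta> \<le> length \<alpha>" "length \<beta> \<noteq> length \<alpha>"
    by (auto simp: strict_subseq_def list_emb_length dest: subseq_same_length)
  with neq have len: "length \<beta> + 2 \<le> length \<alpha>" by simp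
  let ?R = "\<lambda>u v. (u, v) \<in> parcs G"
  have walks: "successively ?R \<beta>" "successively ?R \<alpha>"
    using \<alpha> \<beta> by (auto simp: allowed_path_iff)
  obtain \<delta>\<^sub>1 \<delta>\<^sub>2 where neq': "\<delta>\<^sub>1 \<noteq> \<delta>\<^sub>2" and
    \<delta>: "\<And>\<delta>. \<delta> \<in> {\<delta>\<^sub>1, \<delta>\<^sub>2} \<Longrightarrow> strict_subseq \<delta> \<alpha> \<and> length \<delta> + 1 = length \<alpha>
      \<and> path_value f \<delta> = path_value f \<alpha> \<and> successively ?R \<delta>"
    using two_faces_same_value[OF strict len nonneg_on_path[OF \<alpha>] val walks
      edge_distinct_not_both_zero] by blast
  have "allowed_path G \<delta>" if "\<delta> \<in> {\<delta>\<^sub>1, \<delta>\<^sub>2}" for \<delta>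
  proof -
    have "set \<delta> \<subseteq> set \<alpha>"
      using \<delta>[OF that] by (auto simp: strict_subseq_def dest: list_emb_set)
    \<comment> \<open>By \<open>len\<close>, \<alpha> has at least two vertices, so removing one
      leaves a path.\<close>
    moreover have "\<delta> \<noteq> []" using \<delta>[OF that] len by auto
    ultimately show ?thesis using \<alpha> \<delta>[OF that] by (auto simp: allowed_path_iff)
  qed
  then show False
    using face_unique[OF \<alpha>, of \<delta>\<^sub>1 \<delta>\<^sub>2] neq' \<delta> by (simp add: path_less_def)
qed

text \<open>Both Morse bounds enter: the one on faces of each longer path forces its length, then
  the one on cofaces of \<alpha> applies.\<close>

lemma superpath_same_value_unique:
  assumes "allowed_path G \<alpha>" "allowed_path G \<gamma>\<^sub>1" "allowed_path G \<gamma>\<^sub>2"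
    and "path_less \<alpha> \<gamma>\<^sub>1" "path_less \<alpha> \<gamma>\<^sub>2"
    and "path_value f \<gamma>\<^sub>1 = path_value f \<alpha>" "path_value f \<gamma>\<^sub>2 = path_value f \<alpha>"
  shows "\<gamma>\<^sub>1 = \<gamma>\<^sub>2"
  using coface_unique[of \<alpha> \<gamma>\<^sub>1 \<gamma>\<^sub>2] length_of_same_value[of \<gamma>\<^sub>1 \<alpha>] length_of_same_value[of \<gamma>\<^sub>2 \<alpha>]
    assms by simp

lemma subpath_same_value_unique:
  assumes "allowed_path G \<alpha>" "allowed_path G \<beta>\<^sub>1" "allowed_path G \<beta>\<^sub>2"
    and "path_less \<beta>\<^sub>1 \<alpha>" "path_less \<beta>\<^sub>2 \<alpha>"
    and "path_value f \<beta>\<^sub>1 = path_value f \<alpha>" "path_value f \<beta>\<^sub>2 = path_value f \<alpha>"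
  shows "\<beta>\<^sub>1 = \<beta>\<^sub>2"
  using face_unique[of \<alpha> \<beta>\<^sub>1 \<beta>\<^sub>2] length_of_same_value[of \<alpha> \<beta>\<^sub>1] length_of_same_value[of \<alpha> \<beta>\<^sub>2]
    assms by simp

text \<open>Both values lie weakly on the correct side of that of \<alpha> and at most one of them
  equals it, so their mean lies strictly on that side.\<close>

lemma Witten_Morse: "discrete_Witten_Morse G f"
  unfolding discrete_Witten_Morse_def
proof (intro conjI allI impI; (elim conjE)?)
  show "nonneg_on_verts G f" using Morse by (simp add: discrete_Morse_def)
next
  fix \<alpha> \<gamma>\<^sub>1 \<gamma>\<^sub>2
  assume *: "allowed_path G \<alpha>" "allowed_path G \<gamma>\<^sub>1" "allowed_path G \<gamma>\<^sub>2"
    "path_less \<alpha> \<gamma>\<^sub>1" "path_less \<alpha> \<gamma>\<^sub>2" "\<gamma>\<^sub>1 \<noteq> \<gamma>\<^sub>2"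
  have "path_value f \<alpha> \<le> path_value f \<gamma>\<^sub>1" "path_value f \<alpha> \<le> path_value f \<gamma>\<^sub>2"
    using * path_value_mono by auto
  moreover have "\<not> (path_value f \<gamma>\<^sub>1 = path_value f \<alpha> \<and> path_value f \<gamma>\<^sub>2 = path_value f \<alpha>)"
    using * superpath_same_value_unique by blast
  ultimately show "path_value f \<alpha> < 1/2 * (path_value f \<gamma>\<^sub>1 + path_value f \<gamma>\<^sub>2)" by argo
next
  fix \<alpha> \<beta>\<^sub>1 \<beta>\<^sub>2
  assume *: "allowed_path G \<alpha>" "allowed_path G \<beta>\<^sub>1" "allowed_path G \<beta>\<^sub>2"
    "path_less \<beta>\<^sub>1 \<alpha>" "path_less \<beta>\<^sub>2 \<alpha>" "\<beta>\<^sub>1 \<noteq> \<beta>\<^sub>2"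
  have "path_value f \<beta>\<^sub>1 \<le> path_value f \<alpha>" "path_value f \<beta>\<^sub>2 \<le> path_value f \<alpha>"
    using * path_value_mono by auto
  moreover have "\<not> (path_value f \<beta>\<^sub>1 = path_value f \<alpha> \<and> path_value f \<beta>\<^sub>2 = path_value f \<alpha>)"
    using * subpath_same_value_unique by blast
  ultimately show "1/2 * (path_value f \<beta>\<^sub>1 + path_value f \<beta>\<^sub>2) < path_value f \<alpha>" by argo
qed

end

theorem proposition2p8:
  fixes G :: "'a pair_pre_digraph" and f :: "'a \<Rightarrow> real"
  assumes "is_digraph G"
    and "discrete_Morse G f"
  shows "discrete_flat_Witten_Morse G f"
proof -
  interpret Morse_function G f by unfold_locales fact+
  \<comment> \<open>The flatness inequalities concern each path separately, so monotonicity suffices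
    for them.\<close>
  show ?thesis
    using Witten_Morse path_value_mono by (auto simp: discrete_flat_Witten_Morse_def)
qed

end
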